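(* Let $v_1,v_2\in\mathbb{R}^2$ be linearly independent unit vectors and $\lambda_1,\lambda_2>0$. Every $(v_1,v_2)$-Euclidean circle is an ellipse with the same center. In addition, denoting by $l_i$ ($i=1,2$) the line through the center of the circle perpendicular to $v_i$: if $\lambda_1=\lambda_2$ then the axes of the ellipse are the angle bisectors of the lines $l_1$ and $l_2$; if $v_1\perp v_2$ then its axes are the lines $l_1$ and $l_2$; and if $\lambda_1=\lambda_2$ and $v_1\perp v_2$ then it is a Euclidean circle with the same center.
   Context: Write $v_i=(v_{i1},v_{i2})$. The $(v_1,v_2)$-Euclidean distance (with weights $\lambda_1,\lambda_2$) between $P_1=(x_1,y_1)$ and $P_2=(x_2,y_2)$ in $\mathbb{R}^2$ is $$d_{E(v_1,v_2)}(P_1,P_2)=\left[(\lambda_1|v_{11}(x_1-x_2)+v_{12}(y_1-y_2)|)^2+(\lambda_2|v_{21}(x_1-x_2)+v_{22}(y_1-y_2)|)^2\right]^{1/2}.$$ A $(v_1,v_2)$-Euclidean circle with center $C\in\mathbb{R}^2$ and radius $r>0$ is the set $\{P\in\mathbb{R}^2: d_{E(v_1,v_2)}(C,P)=r\}$. Ellipses are in the Euclidean sense and include Euclidean circles; for a Euclidean circle, any two perpendicular lines through the center count as axes. The axes of an ellipse are its (perpendicular) lines of symmetry through its center; the center is its center of symmetry. *)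

theory Defs
  imports "HOL-Analysis.Analysis"
begin

text \<open>
  \<open>lam1\<close> and \<open>lam2\<close> are the weights; this is a metric exactly when the two vectors are linearly
  independent and the weights are nonzero.
\<close>

definition dE :: "real^2 \<Rightarrow> real^2 \<Rightarrow> real \<Rightarrow> real \<Rightarrow> real^2 \<Rightarrow> real^2 \<Rightarrow> real" where
  "dE v1 v2 lam1 lam2 P Q =
     sqrt ((lam1 * \<bar>v1 $ 1 * (P $ 1 - Q $ 1) + v1 $ 2 * (P $ 2 - Q $ 2)\<bar>)\<^sup>2
         + (lam2 * \<bar>v2 $ 1 * (P $ 1 - Q $ 1) + v2 $ 2 * (P $ 2 - Q $ 2)\<bar>)\<^sup>2)"

definition E_circle :: "real^2 \<Rightarrow> real^2 \<Rightarrow> real \<Rightarrow> real \<Rightarrow> real^2 \<Rightarrow> real \<Rightarrow> (real^2) set" where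
  "E_circle v1 v2 lam1 lam2 C r = {P. dE v1 v2 lam1 lam2 C P = r}"

text \<open>
  Ellipses by the two-focus definition. The foci may coincide, which gives the Euclidean circles;
  the strict inequality excludes segments.
\<close>

definition is_ellipse :: "(real^2) set \<Rightarrow> bool" where
  "is_ellipse S \<longleftrightarrow>
     (\<exists>F1 F2 a. dist F1 F2 < 2 * a \<and> S = {P. dist P F1 + dist P F2 = 2 * a})"

definition is_circle :: "(real^2) set \<Rightarrow> bool" where
  "is_circle S \<longleftrightarrow> (\<exists>C \<rho>. 0 < \<rho> \<and> S = sphere C \<rho>)"

definition point_symmetric :: "(real^2) set \<Rightarrow> real^2 \<Rightarrow> bool" where
  "point_symmetric S C \<longleftrightarrow> (\<lambda>P. 2 *\<^sub>R C - P) ` S = S"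

text \<open>\<open>C\<close> is \<^emph>\<open>the\<close> center of symmetry, so uniqueness is part of the notion.\<close>

definition is_center :: "(real^2) set \<Rightarrow> real^2 \<Rightarrow> bool" where
  "is_center S C \<longleftrightarrow> (\<forall>X. point_symmetric S X \<longleftrightarrow> X = C)"

definition is_line :: "(real^2) set \<Rightarrow> bool" where
  "is_line L \<longleftrightarrow> affine L \<and> aff_dim L = 1"

definition perp_lines :: "(real^2) set \<Rightarrow> (real^2) set \<Rightarrow> bool" where
  "perp_lines L M \<longleftrightarrow> is_line L \<and> is_line M \<and>
     (\<forall>P\<in>L. \<forall>Q\<in>L. \<forall>R\<in>M. \<forall>T\<in>M. orthogonal (P - Q) (R - T))"

text \<open>For a nonzero vector \<open>v\<close>, the line through \<open>C\<close> perpendicular to \<open>v\<close>.\<close>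

definition normal_line :: "real^2 \<Rightarrow> real^2 \<Rightarrow> (real^2) set" where
  "normal_line C v = {P. orthogonal v (P - C)}"

text \<open>On a line, \<^const>\<open>closest_point\<close> is the foot of the perpendicular.\<close>

definition reflect_in_line :: "(real^2) set \<Rightarrow> real^2 \<Rightarrow> real^2" where
  "reflect_in_line L P = 2 *\<^sub>R closest_point L P - P"

definition line_of_symmetry :: "(real^2) set \<Rightarrow> (real^2) set \<Rightarrow> bool" where
  "line_of_symmetry S L \<longleftrightarrow> is_line L \<and> reflect_in_line L ` S = S"

text \<open>
  The set \<open>\<A>\<close> consists of the axes of the ellipse \<open>S\<close>. For a Euclidean circle any two perpendicular
  lines through the center qualify. Otherwise \<open>\<A>\<close> has to be the set of \<^emph>\<open>all\<close> lines of symmetry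
  through the center.
\<close>

definition are_axes :: "(real^2) set \<Rightarrow> (real^2) set set \<Rightarrow> bool" where
  "are_axes S \<A> \<longleftrightarrow> is_ellipse S \<and>
     (\<exists>C. is_center S C \<and>
        (\<exists>L M. \<A> = {L, M} \<and> perp_lines L M \<and> C \<in> L \<and> C \<in> M) \<and>
        (\<not> is_circle S \<longrightarrow> \<A> = {L. line_of_symmetry S L \<and> C \<in> L}))"

text \<open>The angle \<open>AZB\<close> at the vertex \<open>Z\<close>, in \<open>[0, \<pi>]\<close>; meaningful for \<open>A \<noteq> Z\<close> and \<open>B \<noteq> Z\<close>.\<close>

definition angle_at :: "real^2 \<Rightarrow> real^2 \<Rightarrow> real^2 \<Rightarrow> real" where
  "angle_at A Z B = arccos (((A - Z) \<bullet> (B - Z)) / (norm (A - Z) * norm (B - Z)))"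

text \<open>
  A bisector of two intersecting lines is a line containing the ray \<open>ZD\<close> that bisects one of the
  angles \<open>AZB\<close> between them. Two such lines exist, since \<open>A\<close> and \<open>B\<close> may lie on either side of \<open>Z\<close>.
\<close>

definition angle_bisector :: "(real^2) set \<Rightarrow> (real^2) set \<Rightarrow> (real^2) set \<Rightarrow> bool" where
  "angle_bisector L M K \<longleftrightarrow> is_line K \<and>
     (\<exists>Z A B D. L \<inter> M = {Z} \<and> A \<in> L - {Z} \<and> B \<in> M - {Z} \<and> Z \<in> K \<and> D \<in> K - {Z} \<and>
        angle_at A Z D = angle_at A Z B / 2 \<and> angle_at D Z B = angle_at A Z B / 2)"

end

theory Submission
  imports Defs
begin

text \<open>
  In an orthonormal frame that diagonalises the quadratic form
  \<open>(lam1 * (v1 \<bullet> x))\<^sup>2 + (lam2 * (v2 \<bullet> x))\<^sup>2\<close> the circle becomes \<open>(x / a)\<^sup>2 + (y / b)\<^sup>2 = 1\<close>. The frame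
  consists of \<open>v1, v2\<close> themselves if these are orthogonal, and of the normalised \<open>v1 + v2\<close> and
  \<open>v1 - v2\<close>, which are normal to the bisectors, if the weights agree. For \<open>a \<noteq> b\<close>, a line of
  symmetry through the center has to reflect the vertex on the first axis into the ellipse, and
  this singles out the two axes.
\<close>

lemma inner_vec2: "(x::real^2) \<bullet> y = x $ 1 * y $ 1 + x $ 2 * y $ 2"
  by (simp add: inner_vec_def sum_2)

lemma vec2_eq_iff: "(x::real^2) = y \<longleftrightarrow> x $ 1 = y $ 1 \<and> x $ 2 = y $ 2"
  by (simp add: vec_eq_iff forall_2)

subsection \<open>Lines in the plane\<close>

lemma normal_line_iff: "P \<in> normal_line C n \<longleftrightarrow> n \<bullet> (P - C) = 0"
  by (simp add: normal_line_def orthogonal_def)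

lemma center_in_normal_line: "C \<in> normal_line C n"
  by (simp add: normal_line_iff)

lemma normal_line_scaleR: "k \<noteq> 0 \<Longrightarrow> normal_line C (k *\<^sub>R n) = normal_line C n"
  by (auto simp: normal_line_iff)

lemma normal_line_uminus: "normal_line C (- n) = normal_line C n"
  by (auto simp: normal_line_iff)

lemma normal_line_hyperplane: "normal_line C n = {x. n \<bullet> x = n \<bullet> C}"
  by (auto simp: normal_line_iff inner_diff_right)

lemma is_line_normal_line:
  assumes "n \<noteq> 0"
  shows "is_line (normal_line C n)"
  using assms by (simp add: is_line_def normal_line_hyperplane affine_hyperplane)

text \<open>A line in the plane has codimension one, so it is a hyperplane. The normal is scaled to
  unit length because the reflection formula needs it.\<close>

lemma is_line_imp_normal_line:
  assumes "is_line L" "C \<in> L"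
  obtains n where "norm n = 1" "L = normal_line C n"
proof -
  have "affine hull L = L" "aff_dim L = DIM(real^2) - 1"
    using assms(1) by (auto simp: is_line_def affine_hull_eq)
  then obtain m b where m: "m \<noteq> 0" "L = {x. m \<bullet> x = b}"
    by (metis aff_dim_eq_hyperplane)
  with assms(2) have "L = normal_line C m"
    by (auto simp: normal_line_hyperplane)
  then have "L = normal_line C ((1 / norm m) *\<^sub>R m)"
    using m(1) by (simp add: normal_line_scaleR)
  with m(1) show thesis
    by (intro that) auto
qed

text \<open>The foot of the perpendicular is \<open>P\<close> without its component along
  \<open>n\<close>. Every \<open>z\<close> on the line has the same
  \<open>n \<bullet> (P - z)\<close>, so by Cauchy-Schwarz none is nearer to
  \<open>P\<close>.\<close>

lemma reflect_in_normal_line: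
  fixes n :: "real^2"
  assumes "norm n = 1"
  shows "reflect_in_line (normal_line C n) P = P - (2 * (n \<bullet> (P - C))) *\<^sub>R n"
proof -
  let ?L = "normal_line C n" and ?F = "P - (n \<bullet> (P - C)) *\<^sub>R n"
  have nn: "n \<bullet> n = 1"
    using assms by (simp add: dot_square_norm)
  have "?F = closest_point ?L P"
  proof (rule closest_point_unique)
    show "convex ?L" "closed ?L"
      by (simp_all add: normal_line_hyperplane convex_hyperplane closed_hyperplane)
    show "?F \<in> ?L"
      by (simp add: normal_line_iff inner_diff_right nn)
    show "\<forall>z\<in>?L. dist P ?F \<le> dist P z"
    proof
      fix z assume "z \<in> ?L"
      then have "n \<bullet> (P - C) = n \<bullet> (P - z)"
        by (simp add: normal_line_iff inner_diff_right)
      then show "dist P ?F \<le> dist P z"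
        using Cauchy_Schwarz_ineq2[of n "P - z"] assms by (simp add: dist_norm)
    qed
  qed
  then have "reflect_in_line ?L P = 2 *\<^sub>R ?F - P"
    by (simp add: reflect_in_line_def)
  then show ?thesis
    by (simp add: vec2_eq_iff algebra_simps)
qed

text \<open>The counterclockwise quarter turn. It converts a normal of a line into a direction of
  that line.\<close>

definition rot90 :: "real^2 \<Rightarrow> real^2" where
  "rot90 v = vector [- v $ 2, v $ 1]"

lemma rot90_nth [simp]: "rot90 v $ 1 = - v $ 2" "rot90 v $ 2 = v $ 1"
  by (simp_all add: rot90_def)

lemma inner_rot90_rot90 [simp]: "rot90 v \<bullet> rot90 w = v \<bullet> w"
  by (simp add: inner_vec2)

lemma inner_rot90_self [simp]: "v \<bullet> rot90 v = 0"
  by (simp add: inner_vec2)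

lemma norm_rot90 [simp]: "norm (rot90 v) = norm v"
  by (simp add: norm_eq_sqrt_inner)

lemma rot90_scaleR: "rot90 (k *\<^sub>R v) = k *\<^sub>R rot90 v"
  by (simp add: vec2_eq_iff)

lemma orthogonal_unit_imp_rot90:
  fixes n x :: "real^2"
  assumes "norm n = 1" "n \<bullet> x = 0"
  shows "x = (rot90 n \<bullet> x) *\<^sub>R rot90 n"
proof -
  have "n \<bullet> n = 1"
    using assms by (simp add: dot_square_norm)
  with assms(2) show ?thesis
    unfolding vec2_eq_iff inner_vec2 vector_scaleR_component real_scaleR_def rot90_nth by algebra
qed

text \<open>Both normals are orthogonal to \<open>D - C\<close>, hence nonzero multiples of its
  normalised quarter turn.\<close>

lemma normal_line_eqI:
  fixes n m :: "real^2"
  assumes "D \<in> normal_line C n" "D \<in> normal_line C m" "D \<noteq> C" "n \<noteq> 0" "m \<noteq> 0"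
  shows "normal_line C n = normal_line C m"
proof -
  let ?d = "D - C" let ?e = "rot90 (sgn ?d)"
  have d: "norm (sgn ?d) = 1" "sgn ?d \<bullet> n = 0" "sgn ?d \<bullet> m = 0"
    using assms by (auto simp: norm_sgn normal_line_iff sgn_div_norm inner_commute)
  have n: "n = (?e \<bullet> n) *\<^sub>R ?e" and m: "m = (?e \<bullet> m) *\<^sub>R ?e"
    using d by (auto intro: orthogonal_unit_imp_rot90)
  with assms(4,5) have "?e \<bullet> n \<noteq> 0" "?e \<bullet> m \<noteq> 0"
    by auto
  then show ?thesis
    by (metis n m normal_line_scaleR)
qed

subsection \<open>Ellipses in principal axes\<close>

locale orthonormal_frame =
  fixes u w :: "real^2"
  assumes norm_u: "norm u = 1" and norm_w: "norm w = 1" and inner_uw: "u \<bullet> w = 0"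
begin

lemma inner_frame [simp]: "u \<bullet> u = 1" "w \<bullet> w = 1" "u \<bullet> w = 0" "w \<bullet> u = 0"
  using norm_u norm_w inner_uw by (simp_all add: dot_square_norm inner_commute)

lemma frame_expand: "x = (u \<bullet> x) *\<^sub>R u + (w \<bullet> x) *\<^sub>R w"
proof -
  \<comment> \<open>A square matrix with orthonormal columns also has orthonormal rows;
    \<open>algebra\<close> derives the expansion from these three relations.\<close>
  have "u $ 1 * u $ 1 + u $ 2 * u $ 2 = 1" "w $ 1 * w $ 1 + w $ 2 * w $ 2 = 1"
    "u $ 1 * w $ 1 + u $ 2 * w $ 2 = 0"
    using inner_frame by (simp_all add: inner_vec2)
  then show ?thesis
    unfolding vec2_eq_iff inner_vec2 vector_scaleR_component real_scaleR_def vector_add_component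
    by algebra
qed

lemma inner_frame_expand: "x \<bullet> y = (u \<bullet> x) * (u \<bullet> y) + (w \<bullet> x) * (w \<bullet> y)"
  by (subst frame_expand[of x]) (simp add: inner_add_left)

lemma norm_frame_expand: "(norm x)\<^sup>2 = (u \<bullet> x)\<^sup>2 + (w \<bullet> x)\<^sup>2"
  unfolding power2_norm_eq_inner using inner_frame_expand[of x x] by (simp only: power2_eq_square)

lemma frame_eqI: "u \<bullet> x = u \<bullet> y \<Longrightarrow> w \<bullet> x = w \<bullet> y \<Longrightarrow> x = y"
  using frame_expand[of x] frame_expand[of y] by simp

end

text \<open>No order between \<open>a\<close> and \<open>b\<close> is imposed, so the frame vectors
  may be exchanged along with the semi-axes.\<close>

definition axis_ellipse :: "real^2 \<Rightarrow> real^2 \<Rightarrow> real \<Rightarrow> real \<Rightarrow> real^2 \<Rightarrow> (real^2) set" where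
  "axis_ellipse u w a b C = {P. (u \<bullet> (P - C) / a)\<^sup>2 + (w \<bullet> (P - C) / b)\<^sup>2 = 1}"

lemma axis_ellipse_swap: "axis_ellipse w u b a C = axis_ellipse u w a b C"
  by (simp add: axis_ellipse_def add.commute)

text \<open>The distances to the foci \<open>(\<plusminus>c, 0)\<close> are \<open>a \<minusplus> c x / a\<close>: their squares differ by \<open>4 c x\<close>.\<close>

lemma sum_focal_distances:
  fixes a b c x y :: real
  assumes ab: "0 < a" "0 < b" and c: "0 \<le> c" "c\<^sup>2 = a\<^sup>2 - b\<^sup>2"
  shows "sqrt ((x - c)\<^sup>2 + y\<^sup>2) + sqrt ((x + c)\<^sup>2 + y\<^sup>2) = 2 * a \<longleftrightarrow> (x / a)\<^sup>2 + (y / b)\<^sup>2 = 1"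
    (is "?d + ?e = _ \<longleftrightarrow> ?E")
proof -
  have ca: "c \<le> a"
    using ab c by (auto intro: power2_le_imp_le[of c a])
  have sq: "?d\<^sup>2 = (x - c)\<^sup>2 + y\<^sup>2" "?e\<^sup>2 = (x + c)\<^sup>2 + y\<^sup>2"
    by simp_all
  have b2: "b\<^sup>2 = a\<^sup>2 - c\<^sup>2"
    using c by simp
  have eqE: "?E \<longleftrightarrow> b\<^sup>2 * x\<^sup>2 + a\<^sup>2 * y\<^sup>2 = a\<^sup>2 * b\<^sup>2"
    using ab by (auto simp: power_divide field_simps)
  have key: "(x - c)\<^sup>2 + y\<^sup>2 = (a - c * x / a)\<^sup>2 \<longleftrightarrow> ?E"
  proof -
    have "(x - c)\<^sup>2 + y\<^sup>2 = (a - c * x / a)\<^sup>2 \<longleftrightarrow> a\<^sup>2 * ((x - c)\<^sup>2 + y\<^sup>2) = (a\<^sup>2 - c * x)\<^sup>2"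
      using ab by (simp add: power2_eq_square field_simps)
    also have "\<dots> \<longleftrightarrow> ?E"
      unfolding eqE b2 by (simp add: power2_eq_square algebra_simps)
    finally show ?thesis .
  qed
  have key': "(x + c)\<^sup>2 + y\<^sup>2 = (a + c * x / a)\<^sup>2 \<longleftrightarrow> (x - c)\<^sup>2 + y\<^sup>2 = (a - c * x / a)\<^sup>2"
    using ab by (simp add: power2_eq_square field_simps)
  show ?thesis
  proof
    assume s: "?d + ?e = 2 * a"
    \<comment> \<open>Dividing the difference of squares by the sum \<open>2 * a\<close> gives the
      difference of the distances, and with it each distance.\<close>
    have "?e\<^sup>2 - ?d\<^sup>2 = 4 * c * x"
      unfolding sq by (simp add: power2_eq_square algebra_simps)
    then have "(?e - ?d) * (2 * a) = 4 * c * x"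
      unfolding s[symmetric] by (simp add: power2_eq_square algebra_simps)
    then have "?e - ?d = 2 * (c * x / a)"
      using ab by (simp add: field_simps)
    with s have "?d = a - c * x / a"
      by simp
    with sq(1) key show ?E
      by simp
  next
    assume E: ?E
    \<comment> \<open>From \<open>\<bar>x\<bar> \<le> a\<close> and \<open>c \<le> a\<close> both
      candidates for the distances are nonnegative, so they are the square roots of their
      squares.\<close>
    have "(x / a)\<^sup>2 \<le> 1"
      using E by (smt (verit) zero_le_power2)
    then have "\<bar>x\<bar> \<le> a"
      using ab by (simp add: abs_square_le_1)
    then have "c * \<bar>x\<bar> \<le> a * a"
      using c ca by (intro mult_mono) auto
    then have "\<bar>c * x / a\<bar> \<le> a"
      using ab c by (simp add: abs_mult field_simps)
    then show "?d + ?e = 2 * a"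
      using E key key' unfolding abs_le_iff by simp
  qed
qed

locale ellipse_frame = orthonormal_frame +
  fixes a b :: real and C :: "real^2"
  assumes a_pos: "0 < a" and b_pos: "0 < b"
begin

text \<open>In coordinates scaled by the semi-axes the ellipse is the unit circle. Images of single
  points under symmetries are tested in this form.\<close>

lemma point_in_axis_ellipse:
  "C + (a * s) *\<^sub>R u + (b * t) *\<^sub>R w \<in> axis_ellipse u w a b C \<longleftrightarrow> s\<^sup>2 + t\<^sup>2 = 1"
  using a_pos b_pos by (simp add: axis_ellipse_def inner_add_right add.assoc)

lemma axis_ellipse_circle:
  assumes "a = b"
  shows "axis_ellipse u w a b C = sphere C a"
proof -
  have "(u \<bullet> (P - C) / a)\<^sup>2 + (w \<bullet> (P - C) / b)\<^sup>2 = (norm (P - C) / a)\<^sup>2" for P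
    using assms by (simp add: power_divide norm_frame_expand add_divide_distrib)
  moreover have "(norm (P - C) / a)\<^sup>2 = 1 \<longleftrightarrow> norm (P - C) = a" for P
    using a_pos norm_ge_zero[of "P - C"] by (auto simp: power2_eq_1_iff field_simps)
  ultimately show ?thesis
    by (auto simp: axis_ellipse_def dist_norm norm_minus_commute)
qed

lemma is_ellipse_if_major:
  assumes "b \<le> a"
  shows "is_ellipse (axis_ellipse u w a b C)"
proof -
  \<comment> \<open>Half the distance between the foci. As \<open>b\<close> is positive,
    \<open>c < a\<close>, so the ellipse does not degenerate to a segment.\<close>
  define c where "c = sqrt (a\<^sup>2 - b\<^sup>2)"
  have c: "0 \<le> c" "c\<^sup>2 = a\<^sup>2 - b\<^sup>2"
    using assms b_pos by (auto simp: c_def power_mono)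
  have "c < a"
    using c a_pos b_pos by (auto intro: power2_less_imp_less[of c a])
  have d: "dist P (C + k *\<^sub>R u) = sqrt ((u \<bullet> (P - C) - k)\<^sup>2 + (w \<bullet> (P - C))\<^sup>2)" for P k
    using norm_frame_expand[of "P - (C + k *\<^sub>R u)"]
    by (simp add: dist_norm real_sqrt_unique inner_diff_right inner_add_right diff_diff_eq)
  have "axis_ellipse u w a b C = {P. dist P (C + c *\<^sub>R u) + dist P (C + (- c) *\<^sub>R u) = 2 * a}"
    using sum_focal_distances[OF a_pos b_pos c] unfolding d axis_ellipse_def by simp
  moreover have "dist (C + c *\<^sub>R u) (C + (- c) *\<^sub>R u) < 2 * a"
    using c \<open>c < a\<close> norm_u by (simp add: dist_norm flip: scaleR_2)
  ultimately show ?thesis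
    unfolding is_ellipse_def by blast
qed

section \<open>Center and lines of symmetry\<close>

lemma is_center_axis_ellipse: "is_center (axis_ellipse u w a b C) C"
  unfolding is_center_def
proof (intro allI iffI)
  let ?S = "axis_ellipse u w a b C"
  fix X
  assume "X = C"
  have sym: "2 *\<^sub>R C - P \<in> ?S \<longleftrightarrow> P \<in> ?S" for P
  proof -
    have "2 *\<^sub>R C - P - C = - (P - C)"
      by (simp add: scaleR_2)
    then show ?thesis
      unfolding axis_ellipse_def mem_Collect_eq by (simp only: inner_minus_right) simp
  qed
  have "P \<in> (\<lambda>P. 2 *\<^sub>R C - P) ` ?S" if "P \<in> ?S" for P
    using that sym by (intro image_eqI[of _ _ "2 *\<^sub>R C - P"]) auto
  with sym \<open>X = C\<close> show "point_symmetric ?S X"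
    by (auto simp: point_symmetric_def)
next
  let ?S = "axis_ellipse u w a b C"
  fix X
  assume X: "point_symmetric ?S X"
  define p q where "p = u \<bullet> (X - C) / a" and "q = w \<bullet> (X - C) / b"
  \<comment> \<open>Here \<open>p\<close> and \<open>q\<close> are the scaled coordinates of
    \<open>X\<close>. The two vertices \<open>s = 1\<close> and \<open>s = -1\<close> on the first
    axis are reflected in \<open>X\<close>; adding the resulting equations cancels the linear terms
    and leaves \<open>p = q = 0\<close>.\<close>
  have "(2 * p - s)\<^sup>2 + (2 * q)\<^sup>2 = 1" if "s\<^sup>2 = 1" for s
  proof -
    have "C + (a * s) *\<^sub>R u + (b * 0) *\<^sub>R w \<in> ?S"
      using that point_in_axis_ellipse[of s 0] by simp
    then have "2 *\<^sub>R X - (C + (a * s) *\<^sub>R u + (b * 0) *\<^sub>R w) \<in> ?S"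
      using X unfolding point_symmetric_def by blast
    moreover have "2 *\<^sub>R X - (C + (a * s) *\<^sub>R u + (b * 0) *\<^sub>R w)
        = C + (a * (2 * p - s)) *\<^sub>R u + (b * (2 * q)) *\<^sub>R w"
    proof -
      have "u \<bullet> (X - C) = a * p" "w \<bullet> (X - C) = b * q"
        using a_pos b_pos by (simp_all add: p_def q_def)
      then have "u \<bullet> X = u \<bullet> C + a * p" "w \<bullet> X = w \<bullet> C + b * q"
        by (simp_all add: inner_diff_right)
      then show ?thesis
        by (intro frame_eqI) (simp_all add: inner_diff_right inner_add_right algebra_simps)
    qed
    ultimately show ?thesis
      by (simp only: point_in_axis_ellipse)
  qed
  from this[of 1] this[of "-1"] have "p\<^sup>2 + q\<^sup>2 = 0"
    by (simp add: power2_eq_square algebra_simps)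
  then have "u \<bullet> X = u \<bullet> C" "w \<bullet> X = w \<bullet> C"
    using a_pos b_pos by (simp_all add: p_def q_def inner_diff_right sum_power2_eq_zero_iff)
  then show "X = C"
    by (rule frame_eqI)
qed

text \<open>The reflection flips the sign of the coordinate along \<open>u\<close>, which enters
  squared. Being an involution, it maps the ellipse onto itself and not merely into itself.\<close>

lemma line_of_symmetry_u: "line_of_symmetry (axis_ellipse u w a b C) (normal_line C u)"
proof -
  let ?S = "axis_ellipse u w a b C" and ?f = "\<lambda>P. P - (2 * (u \<bullet> (P - C))) *\<^sub>R u"
  have f: "reflect_in_line (normal_line C u) = ?f"
    using reflect_in_normal_line[OF norm_u] by auto
  have co: "u \<bullet> (?f P - C) = - (u \<bullet> (P - C))" "w \<bullet> (?f P - C) = w \<bullet> (P - C)" for P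
    by (simp_all add: inner_diff_right)
  have ff: "?f (?f P) = P" for P
    by (rule frame_eqI) (simp_all add: inner_diff_right)
  have "?f P \<in> ?S \<longleftrightarrow> P \<in> ?S" for P
    unfolding axis_ellipse_def mem_Collect_eq co by simp
  moreover have "P \<in> ?f ` ?S" if "?f P \<in> ?S" for P
    using imageI[OF that, of ?f] unfolding ff .
  ultimately have "?f ` ?S = ?S"
    by blast
  moreover have "u \<noteq> 0"
    using norm_u by auto
  ultimately show ?thesis
    by (simp add: line_of_symmetry_def f is_line_normal_line)
qed

lemma line_of_symmetry_imp_axis:
  assumes "a \<noteq> b" "line_of_symmetry (axis_ellipse u w a b C) L" "C \<in> L"
  shows "L = normal_line C u \<or> L = normal_line C w"
proof -
  let ?S = "axis_ellipse u w a b C"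
  from assms obtain n where n: "norm n = 1" "L = normal_line C n"
    by (metis is_line_imp_normal_line line_of_symmetry_def)
  define p q where "p = u \<bullet> n" and "q = w \<bullet> n"
  have pq: "p\<^sup>2 + q\<^sup>2 = 1"
    using norm_frame_expand[of n] n(1) by (simp add: p_def q_def)
  have n_eq: "n = p *\<^sub>R u + q *\<^sub>R w"
    unfolding p_def q_def by (rule frame_expand)
  have "C + (a * 1) *\<^sub>R u + (b * 0) *\<^sub>R w \<in> ?S"
    unfolding point_in_axis_ellipse by simp
  then have "reflect_in_line L (C + (a * 1) *\<^sub>R u + (b * 0) *\<^sub>R w) \<in> ?S"
    using assms(2) unfolding line_of_symmetry_def by blast
  moreover have "reflect_in_line L (C + (a * 1) *\<^sub>R u + (b * 0) *\<^sub>R w)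
      = C + (a * (1 - 2 * p\<^sup>2)) *\<^sub>R u + (b * (- 2 * a * p * q / b)) *\<^sub>R w"
    unfolding n(2) reflect_in_normal_line[OF n(1)] using b_pos
    by (intro frame_eqI)
      (simp_all add: n_eq inner_add_left inner_add_right inner_diff_right power2_eq_square
        algebra_simps)
  ultimately have "(1 - 2 * p\<^sup>2)\<^sup>2 + (- 2 * a * p * q / b)\<^sup>2 = 1"
    by (simp only: point_in_axis_ellipse)
  then have "b\<^sup>2 * (1 - 2 * p\<^sup>2)\<^sup>2 + (2 * a * p * q)\<^sup>2 = b\<^sup>2"
    using b_pos by (simp add: power_divide field_simps)
  \<comment> \<open>Now \<open>(1 - 2 * p\<^sup>2)\<^sup>2 = 1 - 4 * p\<^sup>2 * q\<^sup>2\<close>,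
    so the equation reduces to the vanishing of
    \<open>(a\<^sup>2 - b\<^sup>2) * p\<^sup>2 * q\<^sup>2\<close>.\<close>
  moreover have "q\<^sup>2 = 1 - p\<^sup>2"
    using pq by simp
  ultimately have "(a\<^sup>2 - b\<^sup>2) * (p\<^sup>2 * q\<^sup>2) = 0"
    by algebra
  moreover have "a\<^sup>2 \<noteq> b\<^sup>2"
    using assms(1) a_pos b_pos by (simp add: power2_eq_iff)
  ultimately have "p = 0 \<and> q \<noteq> 0 \<or> q = 0 \<and> p \<noteq> 0"
    using pq by auto
  then consider "p = 0" "q \<noteq> 0" | "q = 0" "p \<noteq> 0"
    by blast
  then show ?thesis
    by cases (simp_all add: n(2) n_eq normal_line_scaleR)
qed

lemma perp_lines_axes: "perp_lines (normal_line C u) (normal_line C w)"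
proof -
  have "u \<noteq> 0" "w \<noteq> 0"
    using norm_u norm_w by auto
  moreover have "(P - Q) \<bullet> (R - T) = 0"
    if "P \<in> normal_line C u" "Q \<in> normal_line C u" "R \<in> normal_line C w" "T \<in> normal_line C w"
    for P Q R T
    using that by (simp add: inner_frame_expand[of "P - Q"] normal_line_iff inner_diff_right)
  ultimately show ?thesis
    by (auto simp: perp_lines_def is_line_normal_line orthogonal_def)
qed

end

context ellipse_frame
begin

text \<open>The same ellipse seen in the exchanged frame: this covers the case that \<open>b\<close>
  is the major semi-axis and makes the normal line of \<open>w\<close> a line of symmetry.\<close>

interpretation swapped: ellipse_frame w u b a C
  by unfold_locales (simp_all add: norm_u norm_w a_pos b_pos)

lemma is_ellipse_axis_ellipse: "is_ellipse (axis_ellipse u w a b C)"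
  using is_ellipse_if_major swapped.is_ellipse_if_major linear
  unfolding axis_ellipse_swap[of w u b a] by blast

lemma are_axes_axis_ellipse:
  "are_axes (axis_ellipse u w a b C) {normal_line C u, normal_line C w}"
proof -
  let ?S = "axis_ellipse u w a b C"
  have "{normal_line C u, normal_line C w} = {L. line_of_symmetry ?S L \<and> C \<in> L}"
    if "\<not> is_circle ?S"
  proof -
    have "a \<noteq> b"
      using that axis_ellipse_circle a_pos by (auto simp: is_circle_def)
    moreover have "line_of_symmetry ?S (normal_line C w)"
      using swapped.line_of_symmetry_u by (simp add: axis_ellipse_swap)
    ultimately show ?thesis
      using line_of_symmetry_imp_axis line_of_symmetry_u
      by (auto simp: center_in_normal_line)
  qed
  then show ?thesis
    unfolding are_axes_def
    by (intro conjI exI[of _ C] exI[of _ "normal_line C u"] exI[of _ "normal_line C w"] impI refl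
      is_ellipse_axis_ellipse is_center_axis_ellipse perp_lines_axes center_in_normal_line)
qed

end

subsection \<open>Angle bisectors\<close>

lemma cos_angle_at:
  "cos (angle_at A Z B) = (A - Z) \<bullet> (B - Z) / (norm (A - Z) * norm (B - Z))"
proof -
  have "\<bar>(A - Z) \<bullet> (B - Z) / (norm (A - Z) * norm (B - Z))\<bar> \<le> 1"
    using Cauchy_Schwarz_ineq2[of "A - Z" "B - Z"]
    \<comment> \<open>If a norm vanishes, division by zero makes the quotient 0.\<close>
    by (cases "norm (A - Z) * norm (B - Z) = 0") (auto simp: abs_mult divide_le_eq)
  then show ?thesis
    by (simp add: angle_at_def cos_arccos_abs)
qed

text \<open>The half-angle formula; half of an angle in [0, pi] has nonnegative cosine, which fixes
  the sign of the root.\<close>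

lemma arccos_half_angle:
  assumes "-1 \<le> c" "c \<le> 1"
  shows "arccos (sqrt ((1 + c) / 2)) = arccos c / 2"
proof -
  have t: "0 \<le> arccos c" "arccos c \<le> pi"
    using assms by (auto simp: arccos_lbound arccos_ubound)
  have "0 \<le> cos (arccos c / 2)"
    using t by (intro cos_ge_zero) auto
  moreover have "(cos (arccos c / 2))\<^sup>2 = (1 + c) / 2"
    using cos_double_cos[of "arccos c / 2"] assms by simp
  ultimately have "sqrt ((1 + c) / 2) = cos (arccos c / 2)"
    by (intro real_sqrt_unique) auto
  with t show ?thesis
    by (simp add: arccos_cos)
qed

text \<open>The sum of two unit vectors bisects the angle between them. The quarter turn carries
  this from the normals to the directions of the lines.\<close>

lemma angle_bisector_normal_lineI:
  assumes "norm v1 = 1" "norm v2 = 1" "normal_line C v1 \<inter> normal_line C v2 = {C}"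
    and "v1 + v2 \<noteq> 0"
  shows "angle_bisector (normal_line C v1) (normal_line C v2) (normal_line C (v1 + v2))"
proof -
  define c where "c = v1 \<bullet> v2"
  let ?A = "C + rot90 v1" and ?B = "C + rot90 v2" and ?D = "C + rot90 (v1 + v2)"
  have v: "v1 \<bullet> v1 = 1" "v2 \<bullet> v2 = 1"
    using assms by (simp_all add: dot_square_norm)
  have c1: "-1 \<le> c" "c \<le> 1"
    using Cauchy_Schwarz_ineq2[of v1 v2] assms(1,2) by (auto simp: c_def)
  have n: "norm (v1 + v2) = sqrt (2 * (1 + c))"
    by (simp add: norm_eq_sqrt_inner inner_add_left inner_add_right v c_def inner_commute)
  have "norm (v1 + v2) \<noteq> 0"
    using assms(4) by simp
  with c1 have c: "1 + c > 0"
    unfolding n by (simp add: less_le)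
  \<comment> \<open>The left side is the cosine of the angle between either unit vector and the sum,
    the right side the cosine of half the angle between the two.\<close>
  have half: "(1 + c) / sqrt (2 * (1 + c)) = sqrt ((1 + c) / 2)"
  proof (rule real_sqrt_unique[symmetric])
    show "((1 + c) / sqrt (2 * (1 + c)))\<^sup>2 = (1 + c) / 2"
      using c by (simp add: power_divide power2_eq_square field_simps)
  qed (use c in simp)
  have "angle_at ?A C ?B = arccos c"
    "angle_at ?A C ?D = arccos ((1 + c) / sqrt (2 * (1 + c)))"
    "angle_at ?D C ?B = arccos ((1 + c) / sqrt (2 * (1 + c)))"
    by (simp_all add: angle_at_def assms(1,2) n inner_add_left inner_add_right v c_def
      inner_commute add.commute)
  then have "angle_at ?A C ?D = angle_at ?A C ?B / 2" "angle_at ?D C ?B = angle_at ?A C ?B / 2"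
    by (simp_all only: half arccos_half_angle[OF c1])
  moreover have "?A \<noteq> C" "?B \<noteq> C" "?D \<noteq> C"
    using assms by (auto simp flip: norm_eq_zero[of "rot90 _"])
  ultimately show ?thesis
    unfolding angle_bisector_def using assms(3,4)
    by (intro conjI exI[of _ C] exI[of _ ?A] exI[of _ ?B] exI[of _ ?D])
      (auto simp: is_line_normal_line normal_line_iff)
qed

text \<open>Equal angles have equal cosines, so \<open>D - C\<close> is orthogonal to the difference
  of the unit vectors towards \<open>A\<close> and \<open>B\<close>. These are quarter turns of the
  normals up to sign, which leaves two directions.\<close>

lemma angle_bisector_normal_lineD:
  assumes v: "norm v1 = 1" "norm v2 = 1" "normal_line C v1 \<inter> normal_line C v2 = {C}"
    and nz: "v1 + v2 \<noteq> 0" "v1 - v2 \<noteq> 0"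
    and K: "angle_bisector (normal_line C v1) (normal_line C v2) K"
  shows "K = normal_line C (v1 + v2) \<or> K = normal_line C (v1 - v2)"
proof -
  from K v(3) obtain A B D where AB: "A \<in> normal_line C v1" "A \<noteq> C" "B \<in> normal_line C v2" "B \<noteq> C"
    and KD: "is_line K" "C \<in> K" "D \<in> K" "D \<noteq> C"
    and ang: "angle_at A C D = angle_at D C B"
    unfolding angle_bisector_def by fastforce
  from KD obtain n where n: "norm n = 1" "K = normal_line C n"
    by (metis is_line_imp_normal_line)
  let ?d = "D - C"
  have unit: "\<exists>s. (s = 1 \<or> s = -1) \<and> sgn (X - C) = s *\<^sub>R rot90 v"
    if "norm v = 1" "X \<in> normal_line C v" "X \<noteq> C" for X v
  proof -
    have "v \<bullet> sgn (X - C) = 0"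
      using that by (simp add: normal_line_iff sgn_div_norm)
    then have "sgn (X - C) = (rot90 v \<bullet> sgn (X - C)) *\<^sub>R rot90 v"
      by (rule orthogonal_unit_imp_rot90[OF that(1)])
    then obtain s where s: "sgn (X - C) = s *\<^sub>R rot90 v" ..
    moreover have "norm (sgn (X - C)) = 1"
      using that(3) by (simp add: norm_sgn)
    ultimately have "\<bar>s\<bar> = 1"
      using that(1) by simp
    with s show ?thesis
      by (auto simp: abs_if split: if_splits)
  qed
  obtain s t where s: "s = 1 \<or> s = -1" "sgn (A - C) = s *\<^sub>R rot90 v1"
    and t: "t = 1 \<or> t = -1" "sgn (B - C) = t *\<^sub>R rot90 v2"
    using unit[OF v(1) AB(1,2)] unit[OF v(2) AB(3,4)] by blast
  have "sgn (A - C) \<bullet> ?d / norm ?d = sgn (B - C) \<bullet> ?d / norm ?d"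
    using arg_cong[OF ang, of cos] unfolding cos_angle_at
    by (simp add: sgn_div_norm inner_commute[of "D - C"] divide_inverse mult_ac)
  then have eq: "sgn (A - C) \<bullet> ?d = sgn (B - C) \<bullet> ?d"
    using KD(4) by simp
  text \<open>Turning by a right angle carries the difference of the unit vectors along the two lines
    to \<open>\<plusminus>v1 \<plusminus> v2\<close>, and \<open>v1 + v2\<close> is perpendicular to \<open>v1 - v2\<close>.\<close>
  from s t eq have d: "rot90 (v1 + v2) \<bullet> ?d = 0 \<or> rot90 (v1 - v2) \<bullet> ?d = 0"
    by (auto simp: inner_vec2 algebra_simps)
  have sd: "(v1 + v2) \<bullet> (v1 - v2) = 0"
    using v(1,2) by (simp add: inner_diff_right inner_add_left inner_commute[of v2 v1] dot_square_norm)
  \<comment> \<open>In the plane \<open>y\<close> is a multiple of the quarter turn of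
    \<open>x\<close>. This trades the quarter turn of \<open>v1 + v2\<close> for
    \<open>v1 - v2\<close> and vice versa.\<close>
  have turn: "y \<bullet> ?d = 0" if x: "rot90 x \<bullet> ?d = 0" "x \<bullet> y = 0" "x \<noteq> 0" for x y :: "real^2"
  proof -
    have "y = (rot90 (sgn x) \<bullet> y) *\<^sub>R rot90 (sgn x)"
      using x by (intro orthogonal_unit_imp_rot90) (auto simp: norm_sgn sgn_div_norm)
    moreover have "rot90 (sgn x) \<bullet> ?d = 0"
      using x(1) by (simp add: sgn_div_norm rot90_scaleR)
    ultimately show ?thesis
      by (metis inner_scaleR_left mult_zero_right)
  qed
  have "(v1 - v2) \<bullet> ?d = 0 \<or> (v1 + v2) \<bullet> ?d = 0"
    using d turn sd nz by (metis inner_commute)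
  then have "D \<in> normal_line C (v1 - v2) \<or> D \<in> normal_line C (v1 + v2)"
    by (simp add: normal_line_iff)
  moreover have "n \<noteq> 0"
    using n(1) by auto
  ultimately show ?thesis
    using normal_line_eqI KD(3,4) nz unfolding n(2) by metis
qed

subsection \<open>Principal axes of the weighted distance\<close>

text \<open>If the determinant vanished, \<open>v1\<close> would equal its projection onto the unit
  vector \<open>v2\<close>.\<close>

lemma independent_unit_imp_det:
  fixes v1 v2 :: "real^2"
  assumes "norm v1 = 1" "norm v2 = 1" "v1 \<noteq> v2" "independent {v1, v2}"
  shows "v1 $ 1 * v2 $ 2 - v1 $ 2 * v2 $ 1 \<noteq> 0"
proof
  assume "v1 $ 1 * v2 $ 2 - v1 $ 2 * v2 $ 1 = 0"
  moreover have "v2 $ 1 * v2 $ 1 + v2 $ 2 * v2 $ 2 = 1"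
    using assms(2) by (metis inner_vec2 dot_square_norm one_power2)
  ultimately have "v1 = (v1 \<bullet> v2) *\<^sub>R v2"
    unfolding vec2_eq_iff inner_vec2 vector_scaleR_component real_scaleR_def by algebra
  then have "v1 \<in> span {v2}"
    by (metis span_base span_scale singletonI)
  with assms(3,4) show False
    by (simp add: independent_insert)
qed

text \<open>Cramer's rule for a homogeneous system.\<close>

lemma orthogonal_both_imp_0:
  fixes v1 v2 x :: "real^2"
  assumes "v1 $ 1 * v2 $ 2 - v1 $ 2 * v2 $ 1 \<noteq> 0" "v1 \<bullet> x = 0" "v2 \<bullet> x = 0"
  shows "x = 0"
proof -
  have "(v1 $ 1 * v2 $ 2 - v1 $ 2 * v2 $ 1) * x $ 1 = 0"
    "(v1 $ 1 * v2 $ 2 - v1 $ 2 * v2 $ 1) * x $ 2 = 0"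
    using assms(2,3) unfolding inner_vec2 by algebra+
  with assms(1) show ?thesis
    by (simp add: vec2_eq_iff)
qed

lemma E_circle_eq:
  assumes "0 < r"
  shows "E_circle v1 v2 lam1 lam2 C r =
    {P. (lam1 * (v1 \<bullet> (P - C)))\<^sup>2 + (lam2 * (v2 \<bullet> (P - C)))\<^sup>2 = r\<^sup>2}"
proof -
  have "dE v1 v2 lam1 lam2 C P = sqrt ((lam1 * (v1 \<bullet> (P - C)))\<^sup>2 + (lam2 * (v2 \<bullet> (P - C)))\<^sup>2)" for P
  proof -
    have "v $ 1 * (C $ 1 - P $ 1) + v $ 2 * (C $ 2 - P $ 2) = - (v \<bullet> (P - C))" for v :: "real^2"
      by (simp add: inner_vec2 algebra_simps)
    then show ?thesis
      by (simp add: dE_def power_mult_distrib)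
  qed
  then show ?thesis
    using assms real_sqrt_unique
    by (auto simp: E_circle_def dest: arg_cong[where f = "\<lambda>x. x\<^sup>2"] intro!: real_sqrt_unique)
qed

text \<open>For a unit vector \<open>x\<close> with nonzero radicand, this is the distance from the
  center at which the ray in direction \<open>x\<close> meets the circle, by homogeneity of the
  distance.\<close>

definition semi_axis :: "real^2 \<Rightarrow> real^2 \<Rightarrow> real \<Rightarrow> real \<Rightarrow> real \<Rightarrow> real^2 \<Rightarrow> real" where
  "semi_axis v1 v2 lam1 lam2 r x = r / sqrt ((lam1 * (v1 \<bullet> x))\<^sup>2 + (lam2 * (v2 \<bullet> x))\<^sup>2)"

lemma semi_axis_pos:
  assumes "v1 $ 1 * v2 $ 2 - v1 $ 2 * v2 $ 1 \<noteq> 0" "0 < lam1" "0 < lam2" "0 < r" "norm x = 1"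
  shows "0 < semi_axis v1 v2 lam1 lam2 r x"
proof -
  have "x \<noteq> 0"
    using assms(5) by auto
  then have "v1 \<bullet> x \<noteq> 0 \<or> v2 \<bullet> x \<noteq> 0"
    using orthogonal_both_imp_0[OF assms(1)] by blast
  then have "0 < (lam1 * (v1 \<bullet> x))\<^sup>2 + (lam2 * (v2 \<bullet> x))\<^sup>2"
    using assms by (auto simp: sum_power2_gt_zero_iff)
  with assms(4) show ?thesis
    by (simp add: semi_axis_def)
qed

lemma (in orthonormal_frame) E_circle_eq_axis_ellipse:
  assumes "0 < r"
    and pos: "0 < semi_axis v1 v2 lam1 lam2 r u" "0 < semi_axis v1 v2 lam1 lam2 r w"
    and conj: "lam1\<^sup>2 * (v1 \<bullet> u) * (v1 \<bullet> w) + lam2\<^sup>2 * (v2 \<bullet> u) * (v2 \<bullet> w) = 0"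
  shows "E_circle v1 v2 lam1 lam2 C r =
    axis_ellipse u w (semi_axis v1 v2 lam1 lam2 r u) (semi_axis v1 v2 lam1 lam2 r w) C"
proof -
  let ?Q = "\<lambda>x. (lam1 * (v1 \<bullet> x))\<^sup>2 + (lam2 * (v2 \<bullet> x))\<^sup>2"
  have Q: "?Q x = ?Q u * (u \<bullet> x)\<^sup>2 + ?Q w * (w \<bullet> x)\<^sup>2" for x
  proof -
    have "v \<bullet> x = (u \<bullet> x) * (v \<bullet> u) + (w \<bullet> x) * (v \<bullet> w)" for v
      by (subst frame_expand[of x]) (simp add: inner_add_right)
    note v = this[of v1] this[of v2]
    \<comment> \<open>The mixed term of the quadratic form in frame coordinates; \<open>conj\<close>
      says that its coefficient vanishes.\<close>
    have "?Q x - (?Q u * (u \<bullet> x)\<^sup>2 + ?Q w * (w \<bullet> x)\<^sup>2) = 2 * (u \<bullet> x) * (w \<bullet> x) *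
        (lam1\<^sup>2 * (v1 \<bullet> u) * (v1 \<bullet> w) + lam2\<^sup>2 * (v2 \<bullet> u) * (v2 \<bullet> w))"
      unfolding v by (simp add: power2_eq_square algebra_simps)
    with conj show ?thesis
      by simp
  qed
  have s: "(t / semi_axis v1 v2 lam1 lam2 r x)\<^sup>2 = ?Q x * t\<^sup>2 / r\<^sup>2" for t x
    by (simp add: semi_axis_def power_mult_distrib power_divide mult.commute)
  have "?Q x = r\<^sup>2 \<longleftrightarrow> (u \<bullet> x / semi_axis v1 v2 lam1 lam2 r u)\<^sup>2
      + (w \<bullet> x / semi_axis v1 v2 lam1 lam2 r w)\<^sup>2 = 1" for x
    unfolding s Q[of x] using assms(1) by (auto simp flip: add_divide_distrib)
  then show ?thesis
    unfolding E_circle_eq[OF assms(1)] axis_ellipse_def by blast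
qed

text \<open>The slope \<open>t / q\<close> of the first axis is read off the characteristic equation of the matrix
  with rows \<open>(p, q)\<close> and \<open>(q, s)\<close>.\<close>

lemma principal_axes_exist:
  fixes v1 v2 :: "real^2" and k l :: real
  obtains u w where "orthonormal_frame u w"
    and "k * (v1 \<bullet> u) * (v1 \<bullet> w) + l * (v2 \<bullet> u) * (v2 \<bullet> w) = 0"
proof -
  define p q s where "p = k * (v1 $ 1)\<^sup>2 + l * (v2 $ 1)\<^sup>2"
    and "q = k * v1 $ 1 * v1 $ 2 + l * v2 $ 1 * v2 $ 2"
    and "s = k * (v1 $ 2)\<^sup>2 + l * (v2 $ 2)\<^sup>2"
  have form: "k * (v1 \<bullet> x) * (v1 \<bullet> y) + l * (v2 \<bullet> x) * (v2 \<bullet> y)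
      = p * x $ 1 * y $ 1 + q * (x $ 1 * y $ 2 + x $ 2 * y $ 1) + s * x $ 2 * y $ 2" for x y
    by (simp add: p_def q_def s_def inner_vec2 power2_eq_square algebra_simps)
  have "\<exists>x::real^2. x \<noteq> 0 \<and> k * (v1 \<bullet> x) * (v1 \<bullet> rot90 x) + l * (v2 \<bullet> x) * (v2 \<bullet> rot90 x) = 0"
  proof (cases "q = 0")
    case True
    then show ?thesis
      unfolding form by (intro exI[of _ "vector [1, 0]"]) (simp add: vec2_eq_iff)
  next
    case False
    \<comment> \<open>At \<open>x = (q, t)\<close> the condition reads
      \<open>q * (q\<^sup>2 + (s - p) * t - t\<^sup>2) = 0\<close>; \<open>e\<close> is the root of
      the discriminant of the second factor.\<close>
    define e where "e = sqrt ((s - p)\<^sup>2 + 4 * q\<^sup>2)"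
    define t where "t = (s - p + e) / 2"
    have "e\<^sup>2 = (s - p)\<^sup>2 + 4 * q\<^sup>2"
      by (simp add: e_def)
    moreover have "e = 2 * t - (s - p)"
      by (simp add: t_def field_simps)
    ultimately have "t\<^sup>2 = (s - p) * t + q\<^sup>2"
      by (simp add: power2_eq_square algebra_simps)
    then have "p * q * - t + q * (q * q + t * - t) + s * t * q = 0"
      by algebra
    with False show ?thesis
      unfolding form by (intro exI[of _ "vector [q, t]"]) (simp add: vec2_eq_iff)
  qed
  then obtain x :: "real^2" where x: "x \<noteq> 0"
    "k * (v1 \<bullet> x) * (v1 \<bullet> rot90 x) + l * (v2 \<bullet> x) * (v2 \<bullet> rot90 x) = 0"
    by blast
  let ?c = "1 / norm x"
  have "orthonormal_frame (?c *\<^sub>R x) (?c *\<^sub>R rot90 x)"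
    using x(1) by unfold_locales auto
  moreover have "k * (v1 \<bullet> (?c *\<^sub>R x)) * (v1 \<bullet> (?c *\<^sub>R rot90 x))
      + l * (v2 \<bullet> (?c *\<^sub>R x)) * (v2 \<bullet> (?c *\<^sub>R rot90 x))
      = ?c\<^sup>2 * (k * (v1 \<bullet> x) * (v1 \<bullet> rot90 x) + l * (v2 \<bullet> x) * (v2 \<bullet> rot90 x))"
    by (simp add: power2_eq_square algebra_simps)
  ultimately show thesis
    using x(2) that by (metis mult_zero_right)
qed

theorem theorem5p1:
  fixes v1 v2 C :: "real^2" and lam1 lam2 r :: real
  assumes "norm v1 = 1" and "norm v2 = 1"
    and "v1 \<noteq> v2" and "independent {v1, v2}"
    and "0 < lam1" and "0 < lam2" and "0 < r"
  shows "is_ellipse (E_circle v1 v2 lam1 lam2 C r)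
    \<and> is_center (E_circle v1 v2 lam1 lam2 C r) C
    \<and> (lam1 = lam2 \<longrightarrow>
         are_axes (E_circle v1 v2 lam1 lam2 C r)
           {L. angle_bisector (normal_line C v1) (normal_line C v2) L})
    \<and> (orthogonal v1 v2 \<longrightarrow>
         are_axes (E_circle v1 v2 lam1 lam2 C r) {normal_line C v1, normal_line C v2})
    \<and> (lam1 = lam2 \<and> orthogonal v1 v2 \<longrightarrow>
         (\<exists>\<rho>>0. E_circle v1 v2 lam1 lam2 C r = sphere C \<rho>))"
proof -
  let ?E = "E_circle v1 v2 lam1 lam2 C r" and ?a = "semi_axis v1 v2 lam1 lam2 r"
  note det = independent_unit_imp_det[OF assms(1-4)]
  note pos = semi_axis_pos[OF det assms(5-7)]
  have v: "v1 \<bullet> v1 = 1" "v2 \<bullet> v2 = 1"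
    using assms(1,2) by (simp_all add: dot_square_norm)
  \<comment> \<open>Any orthonormal pair without mixed term presents the circle as an ellipse on its
    axes. Each claim below chooses its own pair.\<close>
  have frame: "ellipse_frame u w (?a u) (?a w) \<and> ?E = axis_ellipse u w (?a u) (?a w) C"
    if "orthonormal_frame u w"
      "lam1\<^sup>2 * (v1 \<bullet> u) * (v1 \<bullet> w) + lam2\<^sup>2 * (v2 \<bullet> u) * (v2 \<bullet> w) = 0" for u w
  proof -
    interpret orthonormal_frame u w
      by fact
    note p = pos[OF norm_u] pos[OF norm_w]
    then have "ellipse_frame u w (?a u) (?a w)"
      by unfold_locales
    then show ?thesis
      using E_circle_eq_axis_ellipse[OF assms(7) p that(2)] by blast
  qed
  obtain u w where uw: "orthonormal_frame u w"
    "lam1\<^sup>2 * (v1 \<bullet> u) * (v1 \<bullet> w) + lam2\<^sup>2 * (v2 \<bullet> u) * (v2 \<bullet> w) = 0"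
    by (rule principal_axes_exist)
  from frame[OF uw] have "is_ellipse ?E" "is_center ?E C"
    by (simp_all add: ellipse_frame.is_ellipse_axis_ellipse ellipse_frame.is_center_axis_ellipse)
  moreover have "are_axes ?E {L. angle_bisector (normal_line C v1) (normal_line C v2) L}"
    if eq: "lam1 = lam2"
  proof -
    have nz: "v1 + v2 \<noteq> 0" "v1 - v2 \<noteq> 0"
      using det by (auto simp: vec2_eq_iff add_eq_0_iff algebra_simps)
    let ?u = "(1 / norm (v1 + v2)) *\<^sub>R (v1 + v2)" and ?w = "(1 / norm (v1 - v2)) *\<^sub>R (v1 - v2)"
    have Z: "normal_line C v1 \<inter> normal_line C v2 = {C}"
      using orthogonal_both_imp_0[OF det, of "_ - C"] by (auto simp: normal_line_iff)
    have "(v1 + v2) \<bullet> (v1 - v2) = 0"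
      by (simp add: v inner_add_left inner_diff_right inner_commute[of v2 v1])
    then have frame_uw: "orthonormal_frame ?u ?w"
      using nz by unfold_locales auto
    \<comment> \<open>The normals agree along their sum and are opposite along their difference, so
      for equal weights the mixed terms cancel.\<close>
    have "v2 \<bullet> ?u = v1 \<bullet> ?u"
      by (simp add: v inner_add_right inner_commute[of v2 v1])
    moreover have "v2 \<bullet> ?w = - (v1 \<bullet> ?w)"
      by (simp add: v inner_diff_right inner_commute[of v2 v1] diff_divide_distrib)
    ultimately have "lam1\<^sup>2 * (v1 \<bullet> ?u) * (v1 \<bullet> ?w) + lam2\<^sup>2 * (v2 \<bullet> ?u) * (v2 \<bullet> ?w) = 0"
      by (simp only: eq mult_minus_right add.right_inverse)
    note uw = frame[OF frame_uw this]
    have "are_axes ?E {normal_line C ?u, normal_line C ?w}"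
      unfolding conjunct2[OF uw] by (rule ellipse_frame.are_axes_axis_ellipse[OF conjunct1[OF uw]])
    moreover have "normal_line C ?u = normal_line C (v1 + v2)"
      "normal_line C ?w = normal_line C (v1 - v2)"
      using nz by (simp_all add: normal_line_scaleR)
    moreover have "{L. angle_bisector (normal_line C v1) (normal_line C v2) L}
        = {normal_line C (v1 + v2), normal_line C (v1 - v2)}"
    proof -
      have "angle_bisector (normal_line C v1) (normal_line C v2) (normal_line C (v1 + v2))"
        using angle_bisector_normal_lineI[OF assms(1,2) Z nz(1)] .
      \<comment> \<open>Replacing \<open>v2\<close> by \<open>- v2\<close> keeps its line and turns
        the sum into the difference.\<close>
      moreover have "angle_bisector (normal_line C v1) (normal_line C v2) (normal_line C (v1 - v2))"
        using angle_bisector_normal_lineI[of v1 "- v2" C] assms(1,2) Z nz(2)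
        by (simp add: normal_line_uminus)
      ultimately show ?thesis
        using angle_bisector_normal_lineD[OF assms(1,2) Z nz] by blast
    qed
    ultimately show ?thesis
      by (simp only:)
  qed
  moreover have "are_axes ?E {normal_line C v1, normal_line C v2}
      \<and> (lam1 = lam2 \<longrightarrow> (\<exists>\<rho>>0. ?E = sphere C \<rho>))"
    if "orthogonal v1 v2"
  proof -
    have o: "v1 \<bullet> v2 = 0" "v2 \<bullet> v1 = 0"
      using that by (simp_all add: orthogonal_def inner_commute)
    have "orthonormal_frame v1 v2"
      using assms(1,2) o by unfold_locales
    then have f: "ellipse_frame v1 v2 (?a v1) (?a v2)" "?E = axis_ellipse v1 v2 (?a v1) (?a v2) C"
      using frame[of v1 v2] o by simp_all
    \<comment> \<open>Both semi-axes equal \<open>r / lam1\<close> here.\<close>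
    have "?E = sphere C (?a v1)" if "lam1 = lam2"
      unfolding f(2) using that
      by (intro ellipse_frame.axis_ellipse_circle[OF f(1)]) (simp add: semi_axis_def o v)
    moreover have "are_axes ?E {normal_line C v1, normal_line C v2}"
      unfolding f(2) by (rule ellipse_frame.are_axes_axis_ellipse[OF f(1)])
    ultimately show ?thesis
      using pos[OF assms(1)] by blast
  qed
  ultimately show ?thesis
    by blast
qed

end
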